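(* For every positive integers $s_{\mathrm{col}}$ and $r$, and every instance of the linearly correlated prophets problem with column sparsity $s_{\mathrm{col}}$ and cardinality constraint $r$, there is an online algorithm with \[\mathbb{E}[\mathrm{ALG}]\ \ge\ \frac{1}{2e^2\max\{1,\,s_{\mathrm{col}}/r\}}\;\mathbb{E}[\mathrm{OPT}].\]
   Context: Linearly correlated prophets problem with cardinality constraint $r$: there are $m$ mutually independent nonnegative random variables $Y_1,\dots,Y_m$ and a matrix $A\in\mathbb{R}_{\ge0}^{n\times m}$; the values are $X_i=\sum_jA_{ij}Y_j$. The column sparsity $s_{\mathrm{col}}$ is the maximum number of nonzero entries in a column of $A$. An online algorithm knows $A$ and the distributions of the $Y_j$, observes $X_1,\dots,X_n$ one at a time (never the $Y_j$), and irrevocably accepts or rejects each, accepting a set $Q$ with $|Q|\le r$; its reward is $\mathrm{ALG}=\sum_{i\in Q}X_i$. The benchmark is $\mathrm{OPT}=\sum_{i=1}^rX^{(i)}$, where $X^{(i)}$ is the $i$-th largest realized value among $X_1,\dots,X_n$. *)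

theory Defs
  imports "HOL-Probability.Probability"
begin

(* An n x m matrix is a function A restricted to row indices i < n and column indices j < m;
   items arrive in the order 0, 1, ..., n - 1. *)

definition column_sparsity :: "nat \<Rightarrow> nat \<Rightarrow> (nat \<Rightarrow> nat \<Rightarrow> real) \<Rightarrow> nat" where
  "column_sparsity n m A = Max (insert 0 ((\<lambda>j. card {i. i < n \<and> A i j \<noteq> 0}) ` {..<m}))"

definition item_value :: "nat \<Rightarrow> (nat \<Rightarrow> nat \<Rightarrow> real) \<Rightarrow> (nat \<Rightarrow> real) \<Rightarrow> nat \<Rightarrow> real" where
  "item_value m A y i = (\<Sum>j<m. A i j * y j)"

definition kth_largest :: "nat \<Rightarrow> (nat \<Rightarrow> real) \<Rightarrow> nat \<Rightarrow> real" where
  "kth_largest n x k = rev (sort (map x [0..<n])) ! (k - 1)"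

(* If r exceeds n, the prophet takes all n values. *)
definition opt_reward :: "nat \<Rightarrow> nat \<Rightarrow> (nat \<Rightarrow> real) \<Rightarrow> real" where
  "opt_reward n r x = (\<Sum>k = 1..min r n. kth_largest n x k)"

(* A (possibly randomized) algorithm is a decision rule acc with a seed u: item i is accepted iff
   acc holds of u and the list of the first i + 1 observed values. Earlier decisions are functions
   of u and this list, so they need not be passed separately. *)
definition accepted :: "nat \<Rightarrow> ('u \<Rightarrow> real list \<Rightarrow> bool) \<Rightarrow> 'u \<Rightarrow> (nat \<Rightarrow> real) \<Rightarrow> nat set" where
  "accepted n acc u x = {i. i < n \<and> acc u (map x [0..<Suc i])}"

definition alg_reward :: "nat \<Rightarrow> ('u \<Rightarrow> real list \<Rightarrow> bool) \<Rightarrow> 'u \<Rightarrow> (nat \<Rightarrow> real) \<Rightarrow> real" where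
  "alg_reward n acc u x = (\<Sum>i\<in>accepted n acc u x. x i)"

definition online_algorithm ::
    "nat \<Rightarrow> nat \<Rightarrow> 'u measure \<Rightarrow> ('u \<Rightarrow> real list \<Rightarrow> bool) \<Rightarrow> bool" where
  "online_algorithm n r S acc \<longleftrightarrow>
     prob_space S \<and>
     (\<forall>i<n. Measurable.pred (S \<Otimes>\<^sub>M (\<Pi>\<^sub>M k\<in>{..i}. borel))
              (\<lambda>(u, x). acc u (map x [0..<Suc i]))) \<and>
     (\<forall>u\<in>space S. \<forall>x. card (accepted n acc u x) \<le> r)"

(* Rewards are nonnegative, so expectations are taken in [0, \<infinity>] and no integrability is needed.
   Under the product measure the seed is independent of the Y j. *)
definition expected_alg ::
    "'a measure \<Rightarrow> nat \<Rightarrow> nat \<Rightarrow> (nat \<Rightarrow> nat \<Rightarrow> real) \<Rightarrow> (nat \<Rightarrow> 'a \<Rightarrow> real) \<Rightarrow>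
     'u measure \<Rightarrow> ('u \<Rightarrow> real list \<Rightarrow> bool) \<Rightarrow> ennreal" where
  "expected_alg M n m A Y S acc =
     (\<integral>\<^sup>+ (u, \<omega>). ennreal (alg_reward n acc u (item_value m A (\<lambda>j. Y j \<omega>))) \<partial>(S \<Otimes>\<^sub>M M))"

definition expected_opt ::
    "'a measure \<Rightarrow> nat \<Rightarrow> nat \<Rightarrow> nat \<Rightarrow> (nat \<Rightarrow> nat \<Rightarrow> real) \<Rightarrow> (nat \<Rightarrow> 'a \<Rightarrow> real) \<Rightarrow> ennreal" where
  "expected_opt M n m r A Y =
     (\<integral>\<^sup>+ \<omega>. ennreal (opt_reward n r (item_value m A (\<lambda>j. Y j \<omega>))) \<partial>M)"

end

theory Submission
  imports Defs
begin

text \<open>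
  Let N = max r s and throw every item independently into one of N buckets, chosen uniformly.
  In each of the first r buckets, accept the first item reaching the bucket's threshold.
  The private part of an item is what it receives from those Y j that contribute to no other
  item of its bucket. It is independent of the remaining values of the bucket, so half of the
  expected maximal private part is a threshold that earns at least itself.
  An optimal item lands in the first r buckets with probability r / N. At most
  (r - 1) + (s - 1) other items are optimal or share a given Y j with it, and none of these is
  in its bucket with probability at least (1 - 1/N)^(2 (N - 1)) \<ge> exp (-2).
  The best of the finitely many bucket assignments does as well as the average one.
\<close>

section \<open>Numerical bound, optimal items and counting of bucket assignments\<close>

text \<open>With \<open>k = N - 1\<close>, the base is the inverse of \<open>1 + 1 / k\<close>, and
  \<open>(1 + 1 / k) ^ k \<le> exp 1\<close> because \<open>1 + x \<le> exp x\<close>. At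
  \<open>N = 1\<close> the base is 0, but so is the exponent, and the power is 1.\<close>

lemma one_minus_inverse_power_ge:
  fixes N :: nat
  assumes "N \<ge> 1"
  shows "exp (-1) \<le> (1 - 1 / real N) ^ (N - 1)"
proof (cases "N = 1")
  case False
  define k where "k = real N - 1"
  have k: "k > 0" "real N = k + 1" using False assms by (auto simp: k_def)
  have "(1 + 1 / k) ^ (N - 1) \<le> exp (1 / k) ^ (N - 1)"
    using k by (intro power_mono) auto
  also have "\<dots> = exp (real (N - 1) * (1 / k))" by (rule exp_of_nat_mult [symmetric])
  also have "\<dots> = exp 1" using k assms by (simp add: of_nat_diff)
  finally have le: "(1 + 1 / k) ^ (N - 1) \<le> exp 1" .
  have inv: "1 - 1 / real N = inverse (1 + 1 / k)" using k by (simp add: field_simps)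
  have "exp (-1) = inverse (exp (1::real))" by (rule exp_minus)
  also have "\<dots> \<le> inverse ((1 + 1 / k) ^ (N - 1))"
    using le k by (intro le_imp_inverse_le zero_less_power) (auto simp: add_pos_pos)
  finally show ?thesis by (simp only: inv power_inverse)
qed simp

text \<open>Sorting the indices by their values, rather than the values themselves, turns the sum of
  order statistics into a sum over a concrete set of items. The later counting can then speak of
  optimal items; ties are resolved by the sort.\<close>

lemma opt_reward_eq_sum:
  obtains B where "B \<subseteq> {..<n}" "card B \<le> r" "opt_reward n r x = (\<Sum>i\<in>B. x i)"
proof -
  define ys where "ys = rev (sort_key x [0..<n])"
  have "sort (map x [0..<n]) = map x (sort_key x [0..<n])"
    by (rule properties_for_sort) (simp_all flip: sort_key_def)
  then have ys: "rev (sort (map x [0..<n])) = map x ys" by (simp add: ys_def rev_map)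
  have len: "length ys = n" and dist: "distinct ys" and set: "set ys = {..<n}"
    by (auto simp: ys_def distinct_sort)
  have "opt_reward n r x = (\<Sum>k<min r n. rev (sort (map x [0..<n])) ! k)"
    unfolding opt_reward_def kth_largest_def
    by (rule sum.reindex_bij_witness [of _ Suc "\<lambda>k. k - 1"]) auto
  also have "\<dots> = (\<Sum>k<min r n. x (ys ! k))"
    unfolding ys by (intro sum.cong) (auto simp: len)
  also have "\<dots> = sum_list (map x (take r ys))"
    by (simp add: sum_list_sum_nth len atLeast0LessThan min.commute)
  also have "\<dots> = (\<Sum>i\<in>set (take r ys). x i)"
    using dist by (simp add: sum_list_distinct_conv_sum_set)
  finally have "opt_reward n r x = (\<Sum>i\<in>set (take r ys). x i)" .
  moreover have "card (set (take r ys)) \<le> r"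
    using card_length [of "take r ys"] by simp
  moreover have "set (take r ys) \<subseteq> {..<n}" using set set_take_subset [of r ys] by simp
  ultimately show ?thesis using that by blast
qed

text \<open>Divided by \<open>N ^ n\<close>, this bounds the probability that \<open>i\<close> falls
  into one of the first \<open>r\<close> buckets and no item of \<open>D\<close> joins it. Once the
  bucket of \<open>i\<close> is fixed, each item of \<open>D\<close> avoids it independently with
  probability \<open>1 - 1 / N\<close>. Since this lies in [0, 1], an upper bound \<open>d\<close>
  on \<open>card D\<close> is enough.\<close>

lemma card_isolating_colourings:
  fixes n N r d :: nat
  assumes i: "i < n" and D: "D \<subseteq> {..<n} - {i}" and "card D \<le> d" and "r \<le> N" "N \<ge> 1"
  shows "real r / real N * (1 - 1 / real N) ^ d * real N ^ n
    \<le> real (card {g \<in> {..<n} \<rightarrow>\<^sub>E {..<N}. g i < r \<and> (\<forall>k\<in>D. g k \<noteq> g i)})" (is "_ \<le> real (card ?G)")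
proof -
  \<comment> \<open>\<open>F c\<close> lists the buckets allowed for each item when \<open>i\<close>
    sits in \<open>c\<close>. The favourable assignments are thus a disjoint union, over
    \<open>c < r\<close>, of product sets.\<close>
  define F where "F c = (\<lambda>k. if k = i then {c} else if k \<in> D then {..<N} - {c} else {..<N})" for c
  have finD: "finite D" using D finite_subset by blast
  have G: "?G = (\<Union>c<r. PiE {..<n} (F c))"
  proof (intro set_eqI iffI)
    fix g assume g: "g \<in> ?G"
    then have "g \<in> PiE {..<n} (F (g i))" by (auto simp: F_def PiE_iff)
    then show "g \<in> (\<Union>c<r. PiE {..<n} (F c))" using g by auto
  next
    fix g assume "g \<in> (\<Union>c<r. PiE {..<n} (F c))"
    then obtain c where c: "c < r" "g \<in> PiE {..<n} (F c)" by auto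
    have gF: "g k \<in> F c k" if "k < n" for k using c that by (auto simp: PiE_iff)
    have gi: "g i = c" using gF [OF i] by (simp add: F_def)
    have "g k < N" if "k < n" for k using gF [OF that] c \<open>r \<le> N\<close> by (auto simp: F_def split: if_splits)
    moreover have "g k \<noteq> c" if "k \<in> D" for k using gF [of k] that D by (auto simp: F_def split: if_splits)
    ultimately show "g \<in> ?G" using c gi by (auto simp: PiE_iff)
  qed
  have cardF: "card (PiE {..<n} (F c)) = (N - 1) ^ card D * N ^ (n - 1 - card D)" if "c < r" for c
  proof -
    have "card (PiE {..<n} (F c)) = (\<Prod>k\<in>{..<n}. card (F c k))" by (simp add: card_PiE)
    also have "\<dots> = (\<Prod>k\<in>{..<n} - {i}. card (F c k))"
      using i by (subst prod.remove [of _ i]) (auto simp: F_def)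
    also have "\<dots> = (\<Prod>k\<in>{..<n} - {i}. if k \<in> D then N - 1 else N)"
      using that \<open>r \<le> N\<close> by (intro prod.cong) (auto simp: F_def)
    also have "\<dots> = (N - 1) ^ card D * N ^ card ({..<n} - {i} - D)"
      using D by (simp add: prod.If_cases Int_absorb1 Diff_eq)
    also have "card ({..<n} - {i} - D) = n - 1 - card D"
      using D i finD by (simp add: card_Diff_subset)
    finally show ?thesis .
  qed
  have "card ?G = (\<Sum>c<r. card (PiE {..<n} (F c)))"
    unfolding G
  proof (rule card_UN_disjoint)
    show "\<forall>c\<in>{..<r}. finite (PiE {..<n} (F c))" by (auto intro!: finite_PiE simp: F_def)
    show "\<forall>c\<in>{..<r}. \<forall>c'\<in>{..<r}. c \<noteq> c' \<longrightarrow> (PiE {..<n} (F c)) \<inter> (PiE {..<n} (F c')) = {}"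
    proof (intro ballI impI equals0I)
      fix c c' g assume "c \<noteq> c'" and g: "g \<in> PiE {..<n} (F c) \<inter> PiE {..<n} (F c')"
      from g have "g i \<in> F c i" "g i \<in> F c' i" using i by (auto simp: PiE_iff)
      with \<open>c \<noteq> c'\<close> show False by (simp add: F_def)
    qed
  qed simp
  also have "\<dots> = r * ((N - 1) ^ card D * N ^ (n - 1 - card D))" using cardF by simp
  finally have card: "real (card ?G) = real r * ((real N - 1) ^ card D * real N ^ (n - 1 - card D))"
    using \<open>N \<ge> 1\<close> by (simp add: of_nat_diff)
  have "card D \<le> n - 1" using card_mono [OF _ D] i by simp
  \<comment> \<open>One coordinate belongs to \<open>i\<close>, \<open>card D\<close> coordinates
    have \<open>N - 1\<close> choices each, and the remaining ones are free.\<close>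
  then have "n = 1 + (card D + (n - 1 - card D))" using i by simp
  then have pow_n: "real N ^ n = real N * (real N ^ card D * real N ^ (n - 1 - card D))"
    by (metis power_add power_one_right)
  have "real r / real N * (1 - 1 / real N) ^ d * real N ^ n
      \<le> real r / real N * (1 - 1 / real N) ^ card D * real N ^ n"
    using assms by (intro mult_right_mono mult_left_mono power_decreasing) auto
  also have "\<dots> = real r / real N * ((1 - 1 / real N) ^ card D * (real N * (real N ^ card D * real N ^ (n - 1 - card D))))"
    by (simp only: pow_n mult.assoc)
  also have "\<dots> = real r * (((1 - 1 / real N) * real N) ^ card D * real N ^ (n - 1 - card D))"
    unfolding power_mult_distrib using \<open>N \<ge> 1\<close> by simp
  also have "(1 - 1 / real N) * real N = real N - 1" using \<open>N \<ge> 1\<close> by (simp add: field_simps)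
  finally show ?thesis using card by simp
qed

section \<open>Private parts and their average over all bucket assignments\<close>

text \<open>The columns are those absent from every other item in the bucket of \<open>i\<close>,
  which is what yields independence from those items. A column with \<open>A i j = 0\<close> may be
  among them and contributes nothing.\<close>

definition private_value ::
    "nat \<Rightarrow> nat \<Rightarrow> (nat \<Rightarrow> nat \<Rightarrow> real) \<Rightarrow> (nat \<Rightarrow> nat) \<Rightarrow> (nat \<Rightarrow> real) \<Rightarrow> nat \<Rightarrow> real" where
  "private_value n m A g y i =
     (\<Sum>j | j < m \<and> (\<forall>k<n. k \<noteq> i \<and> g k = g i \<longrightarrow> A k j = 0). A i j * y j)"

lemma private_value_nonneg:
  assumes "\<And>i j. i < n \<Longrightarrow> j < m \<Longrightarrow> A i j \<ge> 0" "\<And>j. j < m \<Longrightarrow> y j \<ge> 0" "i < n"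
  shows "0 \<le> private_value n m A g y i"
  unfolding private_value_def using assms by (intro sum_nonneg) auto

lemma private_value_le_item_value:
  assumes "\<And>i j. i < n \<Longrightarrow> j < m \<Longrightarrow> A i j \<ge> 0" "\<And>j. j < m \<Longrightarrow> y j \<ge> 0" "i < n"
  shows "private_value n m A g y i \<le> item_value m A y i"
  unfolding private_value_def item_value_def using assms by (intro sum_mono2) auto

lemma card_column_le_sparsity:
  assumes "j < m"
  shows "card {i. i < n \<and> A i j \<noteq> 0} \<le> column_sparsity n m A"
  unfolding column_sparsity_def using assms by (intro Max_ge) auto

text \<open>Isolated items of \<open>B\<close> occupy distinct buckets, so each can be charged to
  the maximum of its own bucket. The inserted 0 covers empty buckets and makes the uncharged ones
  nonnegative.\<close>

lemma sum_isolated_le_sum_Max: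
  fixes Z :: "nat \<Rightarrow> real" and g :: "nat \<Rightarrow> nat"
  assumes B: "B \<subseteq> {..<n}"
  shows "(\<Sum>i | i \<in> B \<and> g i < r \<and> (\<forall>k\<in>B - {i}. g k \<noteq> g i). Z i)
    \<le> (\<Sum>c<r. Max (insert 0 (Z ` {i. i < n \<and> g i = c})))" (is "sum Z ?P \<le> sum ?W _")
proof -
  have "sum Z ?P \<le> (\<Sum>i\<in>?P. ?W (g i))"
    using B by (intro sum_mono Max_ge) auto
  also have "\<dots> = sum ?W (g ` ?P)"
    by (subst sum.reindex) (auto simp: inj_on_def)
  also have "\<dots> \<le> sum ?W {..<r}"
    by (rule sum_mono2) (auto intro!: Max_ge)
  finally show ?thesis .
qed

text \<open>A pointwise averaging bound, for fixed \<open>y\<close>: each term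
  \<open>A i j * y j\<close> of the optimum is collected by every assignment that separates
  \<open>i\<close> from the other optimal items and from the other items using column
  \<open>j\<close>. The random choice of buckets appears as a sum over all \<open>N ^ n\<close>
  assignments.\<close>

lemma sum_colourings_private_value_ge:
  fixes r s n m :: nat and A :: "nat \<Rightarrow> nat \<Rightarrow> real"
  assumes r: "r \<ge> 1" and s: "s \<ge> 1" "column_sparsity n m A \<le> s"
    and A: "\<And>i j. i < n \<Longrightarrow> j < m \<Longrightarrow> A i j \<ge> 0" and y: "\<And>j. j < m \<Longrightarrow> y j \<ge> 0"
    and N: "N = max r s"
  shows "real r / real N * exp (-2) * real N ^ n * opt_reward n r (item_value m A y)
    \<le> (\<Sum>g\<in>{..<n} \<rightarrow>\<^sub>E {..<N}. \<Sum>c<r.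
          Max (insert 0 (private_value n m A g y ` {i. i < n \<and> g i = c})))"
proof -
  let ?G = "{..<n} \<rightarrow>\<^sub>E {..<N}"
  define q where "q = real r / real N * exp (-2) * real N ^ n"
  have finG: "finite ?G" by (simp add: finite_PiE)
  obtain B where B: "B \<subseteq> {..<n}" "card B \<le> r"
    "opt_reward n r (item_value m A y) = (\<Sum>i\<in>B. item_value m A y i)"
    by (rule opt_reward_eq_sum)
  have finB: "finite B" using B(1) finite_subset by blast
  \<comment> \<open>The first half makes \<open>i\<close> the only optimal item of one of the first
    \<open>r\<close> buckets; the second half makes column \<open>j\<close> private to it.\<close>
  define ok where "ok g i j \<longleftrightarrow> (g i < r \<and> (\<forall>k\<in>B - {i}. g k \<noteq> g i)) \<and>
    (\<forall>k<n. k \<noteq> i \<and> g k = g i \<longrightarrow> A k j = 0)" for g :: "nat \<Rightarrow> nat" and i j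
  have count: "q * (A i j * y j) \<le> (\<Sum>g\<in>?G. of_bool (ok g i j) * (A i j * y j))"
    if i: "i \<in> B" and j: "j < m" for i j
  proof (cases "A i j = 0")
    case False
    let ?C = "{k. k < n \<and> A k j \<noteq> 0}"
    \<comment> \<open>As \<open>A i j \<noteq> 0\<close>, the item \<open>i\<close> belongs to both
      sets. Removing it leaves at most \<open>r - 1\<close> and \<open>s - 1\<close> items, each at
      most \<open>N - 1\<close>.\<close>
    define D where "D = (B - {i}) \<union> (?C - {i})"
    have in_n: "i < n" using i B(1) by auto
    have "card D \<le> card (B - {i}) + card (?C - {i})" unfolding D_def by (rule card_Un_le)
    also have "\<dots> = (card B - 1) + (card ?C - 1)" using i False in_n finB by simp
    also have "\<dots> \<le> (N - 1) + (N - 1)"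
      using B(2) card_column_le_sparsity [OF j, of n A] s N by (intro add_mono diff_le_mono) auto
    finally have D: "card D \<le> (N - 1) + (N - 1)" .
    have N1: "N \<ge> 1" using r N by simp
    \<comment> \<open>One factor \<open>exp (-1)\<close> pays for the other optimal items, the other
      one for the items sharing column \<open>j\<close>.\<close>
    have "exp (-2) = exp (-1) * exp (-1 :: real)" by (simp flip: exp_add)
    also have "\<dots> \<le> (1 - 1 / real N) ^ (N - 1) * (1 - 1 / real N) ^ (N - 1)"
      using one_minus_inverse_power_ge [OF N1] N1 by (intro mult_mono) auto
    finally have "exp (-2) \<le> (1 - 1 / real N) ^ ((N - 1) + (N - 1))" by (simp only: power_add)
    then have "q \<le> real r / real N * (1 - 1 / real N) ^ ((N - 1) + (N - 1)) * real N ^ n"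
      unfolding q_def by (intro mult_right_mono mult_left_mono) auto
    also have "\<dots> \<le> real (card {g \<in> ?G. g i < r \<and> (\<forall>k\<in>D. g k \<noteq> g i)})"
      using B(1) N N1 in_n D by (intro card_isolating_colourings) (auto simp: D_def)
    also have "{g \<in> ?G. g i < r \<and> (\<forall>k\<in>D. g k \<noteq> g i)} = {g \<in> ?G. ok g i j}"
      by (auto simp: ok_def D_def)
    also have "real (card {g \<in> ?G. ok g i j}) = (\<Sum>g\<in>?G. of_bool (ok g i j))"
      using finG by (simp add: sum.If_cases of_bool_def Int_def)
    finally have "q \<le> (\<Sum>g\<in>?G. of_bool (ok g i j))" .
    then have "q * (A i j * y j) \<le> (\<Sum>g\<in>?G. of_bool (ok g i j)) * (A i j * y j)"
      using A [OF in_n j] y [OF j] by (intro mult_right_mono) auto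
    then show ?thesis by (simp add: sum_distrib_right)
  qed simp
  \<comment> \<open>Writing private parts with indicators lets the sum over assignments pass the
    sums over items and columns.\<close>
  have isolated: "(\<Sum>i | i \<in> B \<and> g i < r \<and> (\<forall>k\<in>B - {i}. g k \<noteq> g i). private_value n m A g y i)
      = (\<Sum>i\<in>B. \<Sum>j<m. of_bool (ok g i j) * (A i j * y j))" for g
  proof -
    have "(\<Sum>i | i \<in> B \<and> g i < r \<and> (\<forall>k\<in>B - {i}. g k \<noteq> g i). private_value n m A g y i)
      = (\<Sum>i\<in>B. if g i < r \<and> (\<forall>k\<in>B - {i}. g k \<noteq> g i) then private_value n m A g y i else 0)"
      by (rule sum.inter_filter [OF finB])
    also have "\<dots> = (\<Sum>i\<in>B. \<Sum>j<m. of_bool (ok g i j) * (A i j * y j))"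
    proof (rule sum.cong [OF refl])
      fix i
      have "private_value n m A g y i = (\<Sum>j | j \<in> {..<m} \<and> (\<forall>k<n. k \<noteq> i \<and> g k = g i \<longrightarrow> A k j = 0). A i j * y j)"
        by (simp add: private_value_def)
      also have "\<dots> = (\<Sum>j<m. if \<forall>k<n. k \<noteq> i \<and> g k = g i \<longrightarrow> A k j = 0 then A i j * y j else 0)"
        by (rule sum.inter_filter) simp
      finally have priv: "private_value n m A g y i = \<dots>" .
      show "(if g i < r \<and> (\<forall>k\<in>B - {i}. g k \<noteq> g i) then private_value n m A g y i else 0)
          = (\<Sum>j<m. of_bool (ok g i j) * (A i j * y j))"
      proof (cases "g i < r \<and> (\<forall>k\<in>B - {i}. g k \<noteq> g i)")
        case True
        then have "ok g i j \<longleftrightarrow> (\<forall>k<n. k \<noteq> i \<and> g k = g i \<longrightarrow> A k j = 0)" for j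
          by (simp add: ok_def)
        with True show ?thesis
          unfolding priv if_P [OF True] by (intro sum.cong) simp_all
      next
        case False
        then have "\<not> ok g i j" for j by (simp add: ok_def)
        with False show ?thesis by (simp only: if_False) simp
      qed
    qed
    finally show ?thesis .
  qed
  have "q * opt_reward n r (item_value m A y) = (\<Sum>i\<in>B. \<Sum>j<m. q * (A i j * y j))"
    by (simp add: B(3) item_value_def sum_distrib_left)
  also have "\<dots> \<le> (\<Sum>i\<in>B. \<Sum>j<m. \<Sum>g\<in>?G. of_bool (ok g i j) * (A i j * y j))"
    by (intro sum_mono count) auto
  also have "\<dots> = (\<Sum>g\<in>?G. \<Sum>i\<in>B. \<Sum>j<m. of_bool (ok g i j) * (A i j * y j))"
    by (simp only: sum.swap [where B = ?G])
  also have "\<dots> \<le> (\<Sum>g\<in>?G. \<Sum>c<r. Max (insert 0 (private_value n m A g y ` {i. i < n \<and> g i = c})))"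
    unfolding isolated [symmetric]
    by (intro sum_mono sum_isolated_le_sum_Max B(1))
  finally show ?thesis by (simp add: q_def)
qed

section \<open>Threshold stopping within one bucket\<close>

lemma integrable_Max_insert_0:
  fixes Z :: "'i \<Rightarrow> 'a \<Rightarrow> real"
  assumes "finite T" "\<And>i. i \<in> T \<Longrightarrow> integrable M (Z i)"
  shows "integrable M (\<lambda>\<omega>. Max (insert 0 ((\<lambda>i. Z i \<omega>) ` T)))"
  using assms
proof (induction T)
  case (insert i T)
  have "Max (insert 0 ((\<lambda>i. Z i \<omega>) ` insert i T)) = max (Z i \<omega>) (Max (insert 0 ((\<lambda>i. Z i \<omega>) ` T)))" for \<omega>
    using insert.hyps by (subst image_insert, subst insert_commute, subst Max_insert) auto
  then show ?case using insert by (auto intro!: integrable_max)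
qed simp

text \<open>The prophet inequality with half the expected maximum as threshold. The
  \<open>X i\<close> may depend on each other; what matters is that \<open>Z i\<close> is
  independent of whether an earlier item reached the threshold. If p is the probability that no item
  reaches \<open>\<tau>\<close>, accepted items pay a base of \<open>\<tau> * (1 - p)\<close>, and
  the excesses of the \<open>Z i\<close> over \<open>\<tau>\<close> add at least
  \<open>p * \<tau>\<close>.\<close>

lemma (in prob_space) threshold_stopping_half:
  fixes X Z :: "nat \<Rightarrow> 'a \<Rightarrow> real" and T :: "nat set"
  assumes T: "finite T"
    and intX: "\<And>i. i \<in> T \<Longrightarrow> integrable M (X i)"
    and intZ: "\<And>i. i \<in> T \<Longrightarrow> integrable M (Z i)"
    and Z: "\<And>i \<omega>. i \<in> T \<Longrightarrow> \<omega> \<in> space M \<Longrightarrow> Z i \<omega> \<le> X i \<omega>"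
    and indep: "\<And>i t. i \<in> T \<Longrightarrow>
      indep_var borel (Z i) borel (\<lambda>\<omega>. of_bool (\<forall>k\<in>{k\<in>T. k < i}. X k \<omega> < t))"
    and \<tau>: "\<tau> = expectation (\<lambda>\<omega>. Max (insert 0 ((\<lambda>i. Z i \<omega>) ` T))) / 2"
  shows "integrable M (\<lambda>\<omega>. \<Sum>i\<in>T. X i \<omega> * of_bool (\<tau> \<le> X i \<omega> \<and> (\<forall>k\<in>{k\<in>T. k < i}. X k \<omega> < \<tau>)))" (is "integrable M ?R")
    and "\<tau> \<le> expectation (\<lambda>\<omega>. \<Sum>i\<in>T. X i \<omega> * of_bool (\<tau> \<le> X i \<omega> \<and> (\<forall>k\<in>{k\<in>T. k < i}. X k \<omega> < \<tau>)))"
proof -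
  define before where "before i \<omega> = (of_bool (\<forall>k\<in>{k\<in>T. k < i}. X k \<omega> < \<tau>) :: real)" for i \<omega>
  define none where "none \<omega> = (of_bool (\<forall>k\<in>T. X k \<omega> < \<tau>) :: real)" for \<omega>
  define accept where "accept i \<omega> = (of_bool (\<tau> \<le> X i \<omega> \<and> (\<forall>k\<in>{k\<in>T. k < i}. X k \<omega> < \<tau>)) :: real)" for i \<omega>
  define excess where "excess i \<omega> = max 0 (Z i \<omega> - \<tau>)" for i \<omega>
  define W where "W \<omega> = Max (insert 0 ((\<lambda>i. Z i \<omega>) ` T))" for \<omega>
  have mX [measurable]: "X i \<in> borel_measurable M" if "i \<in> T" for i using intX [OF that] by simp
  have mZ [measurable]: "Z i \<in> borel_measurable M" if "i \<in> T" for i using intZ [OF that] by simp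
  have [measurable]: "before i \<in> borel_measurable M" for i
    unfolding before_def of_bool_def using T by measurable
  have [measurable]: "none \<in> borel_measurable M"
    unfolding none_def of_bool_def using T by measurable
  have maccept [measurable]: "accept i \<in> borel_measurable M" if [measurable]: "i \<in> T" for i
    unfolding accept_def of_bool_def using T by measurable
  have int_excess: "integrable M (excess i)" if "i \<in> T" for i
    unfolding excess_def using intZ [OF that] by auto
  have int_before: "integrable M (before i)" for i
    by (rule integrable_const_bound [of _ 1]) (auto simp: before_def)
  have int_none: "integrable M none"
    by (rule integrable_const_bound [of _ 1]) (auto simp: none_def)
  \<comment> \<open>Nonnegativity of \<open>\<tau>\<close> is what bounds the inserted 0 of the
    maximum.\<close>
  have "W \<omega> \<le> \<tau> + (\<Sum>i\<in>T. excess i \<omega>)" if "0 \<le> \<tau>" for \<omega>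
  proof -
    have "Z i \<omega> \<le> \<tau> + (\<Sum>i\<in>T. excess i \<omega>)" if "i \<in> T" for i
    proof -
      have "Z i \<omega> \<le> \<tau> + excess i \<omega>" by (simp add: excess_def)
      also have "excess i \<omega> \<le> (\<Sum>i\<in>T. excess i \<omega>)"
        using that T by (intro member_le_sum) (auto simp: excess_def)
      finally show ?thesis by simp
    qed
    moreover have "0 \<le> \<tau> + (\<Sum>i\<in>T. excess i \<omega>)"
      using that by (intro add_nonneg_nonneg sum_nonneg) (auto simp: excess_def)
    ultimately show ?thesis unfolding W_def using T by (subst Max_le_iff) auto
  qed
  moreover have W0: "0 \<le> W \<omega>" for \<omega> unfolding W_def using T by (intro Max_ge) auto
  moreover have \<tau>0: "0 \<le> \<tau>" using W0 unfolding \<tau> W_def [symmetric] by simp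
  ultimately have W: "W \<omega> \<le> \<tau> + (\<Sum>i\<in>T. excess i \<omega>)" for \<omega> by blast
  have intW: "integrable M W"
    unfolding W_def by (intro integrable_Max_insert_0 T intZ)
  \<comment> \<open>Half of the expected maximum is absorbed by \<open>\<tau>\<close> itself, so the
    expected excesses must supply the other half.\<close>
  have "2 * \<tau> = expectation W" by (simp add: \<tau> W_def [abs_def])
  also have "\<dots> \<le> expectation (\<lambda>\<omega>. \<tau> + (\<Sum>i\<in>T. excess i \<omega>))"
    using intW int_excess W by (intro integral_mono) auto
  also have "\<dots> = \<tau> + (\<Sum>i\<in>T. expectation (excess i))"
    using int_excess by (simp add: prob_space)
  finally have sum_excess: "\<tau> \<le> (\<Sum>i\<in>T. expectation (excess i))" by simp

  have R: "?R = (\<lambda>\<omega>. \<Sum>i\<in>T. X i \<omega> * accept i \<omega>)" by (simp add: accept_def)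
  show intR: "integrable M ?R"
    unfolding R
  proof (rule Bochner_Integration.integrable_sum)
    fix i assume i: "i \<in> T"
    show "integrable M (\<lambda>\<omega>. X i \<omega> * accept i \<omega>)"
      by (rule Bochner_Integration.integrable_bound [OF intX [OF i]]) (use i in \<open>auto simp: accept_def\<close>)
  qed
  have lower: "\<tau> * (1 - none \<omega>) + (\<Sum>i\<in>T. excess i \<omega> * before i \<omega>) \<le> ?R \<omega>" if \<omega>: "\<omega> \<in> space M" for \<omega>
  proof -
    \<comment> \<open>If some item reaches the threshold, the first one to do so is
      accepted.\<close>
    have "1 - none \<omega> \<le> (\<Sum>i\<in>T. accept i \<omega>)"
    proof (cases "\<forall>k\<in>T. X k \<omega> < \<tau>")
      case False
      define i where "i = (LEAST i. i \<in> T \<and> \<tau> \<le> X i \<omega>)"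
      have i: "i \<in> T \<and> \<tau> \<le> X i \<omega>" 
        unfolding i_def by (rule LeastI_ex) (use False in \<open>force simp: not_less\<close>)
      have "X k \<omega> < \<tau>" if "k \<in> T" "k < i" for k
        using not_less_Least [of k "\<lambda>i. i \<in> T \<and> \<tau> \<le> X i \<omega>"] that unfolding i_def by auto
      then have "accept i \<omega> = 1" using i by (simp add: accept_def)
      moreover have "accept i \<omega> \<le> (\<Sum>i\<in>T. accept i \<omega>)"
        using i T by (intro member_le_sum) (auto simp: accept_def)
      ultimately show ?thesis by (simp add: none_def)
    qed (simp add: none_def accept_def sum_nonneg)
    then have "\<tau> * (1 - none \<omega>) + (\<Sum>i\<in>T. excess i \<omega> * before i \<omega>)
        \<le> \<tau> * (\<Sum>i\<in>T. accept i \<omega>) + (\<Sum>i\<in>T. excess i \<omega> * before i \<omega>)"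
      using \<tau>0 by (intro add_right_mono mult_left_mono)
    also have "\<dots> = (\<Sum>i\<in>T. \<tau> * accept i \<omega> + excess i \<omega> * before i \<omega>)"
      by (simp add: sum_distrib_left sum.distrib)
    \<comment> \<open>If \<open>before i\<close> is 0, both sides vanish. If it is 1 and
      \<open>X i\<close> is below \<open>\<tau>\<close>, then so is \<open>Z i\<close>, and the
      excess is 0. In the remaining case \<open>i\<close> is accepted, and the left side is the
      maximum of \<open>\<tau>\<close> and \<open>Z i\<close>, hence at most
      \<open>X i\<close>.\<close>
    also have "\<dots> \<le> (\<Sum>i\<in>T. X i \<omega> * accept i \<omega>)"
    proof (rule sum_mono)
      fix i assume "i \<in> T"
      then show "\<tau> * accept i \<omega> + excess i \<omega> * before i \<omega> \<le> X i \<omega> * accept i \<omega>"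
        using Z [OF \<open>i \<in> T\<close> \<omega>] by (auto simp: accept_def excess_def before_def)
    qed
    finally show ?thesis by (simp add: accept_def)
  qed
  have int_eb: "integrable M (\<lambda>\<omega>. excess i \<omega> * before i \<omega>)"
    and exp_eb: "expectation (\<lambda>\<omega>. excess i \<omega> * before i \<omega>) = expectation (excess i) * expectation (before i)"
    if i: "i \<in> T" for i
  proof -
    \<comment> \<open>The excess is a function of \<open>Z i\<close> alone and inherits its
      independence from \<open>before i\<close>.\<close>
    have "indep_var borel ((\<lambda>z. max 0 (z - \<tau>)) \<circ> Z i) borel ((\<lambda>b. b) \<circ> before i)"
      unfolding before_def by (intro indep_var_compose [OF indep [OF i]]) measurable
    also have "(\<lambda>z. max 0 (z - \<tau>)) \<circ> Z i = excess i" by (auto simp: excess_def)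
    also have "(\<lambda>b. b) \<circ> before i = before i" by (simp add: comp_def)
    finally have "indep_var borel (excess i) borel (before i)" .
    from indep_var_integrable [OF this int_excess [OF i] int_before]
      indep_var_lebesgue_integral [OF this int_excess [OF i] int_before]
    show "integrable M (\<lambda>\<omega>. excess i \<omega> * before i \<omega>)"
      "expectation (\<lambda>\<omega>. excess i \<omega> * before i \<omega>) = expectation (excess i) * expectation (before i)"
      by auto
  qed
  have none1: "expectation none \<le> 1"
    using integral_mono [OF int_none, of "\<lambda>_. 1"] by (simp add: none_def prob_space)
  have none0: "0 \<le> expectation none" by (simp add: none_def)
  \<comment> \<open>The share of \<open>\<tau>\<close> lost when nothing is accepted is repaid by
    the excesses: \<open>none\<close> is at most \<open>before i\<close>, so each excess counts with
    at least the weight \<open>expectation none\<close>.\<close>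
  have "\<tau> = \<tau> * (1 - expectation none) + expectation none * \<tau>" by algebra
  also have "\<dots> \<le> \<tau> * (1 - expectation none) + expectation none * (\<Sum>i\<in>T. expectation (excess i))"
    using none0 sum_excess by (intro add_left_mono mult_left_mono)
  also have "\<dots> = \<tau> * (1 - expectation none) + (\<Sum>i\<in>T. expectation (excess i) * expectation none)"
    by (simp add: sum_distrib_left mult.commute)
  also have "\<dots> \<le> \<tau> * (1 - expectation none) + (\<Sum>i\<in>T. expectation (excess i) * expectation (before i))"
    by (intro add_left_mono sum_mono mult_left_mono integral_mono int_none int_before)
      (auto simp: none_def before_def excess_def)
  also have "\<dots> = expectation (\<lambda>\<omega>. \<tau> * (1 - none \<omega>) + (\<Sum>i\<in>T. excess i \<omega> * before i \<omega>))"
    using int_none int_eb by (simp add: exp_eb prob_space)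
  also have "\<dots> \<le> expectation ?R"
    using int_none int_eb intR lower by (intro integral_mono) auto
  finally show "\<tau> \<le> expectation ?R" .
qed

section \<open>Independence of a private part from the rest of its bucket\<close>

text \<open>The private part of \<open>i\<close> is a function of the \<open>Y j\<close> with
  \<open>j\<close> in \<open>J\<close>. Every other item of its bucket has zero entries on
  \<open>J\<close>, so its value is a function of the \<open>Y j\<close> with \<open>j\<close> in
  the complement \<open>L\<close>. Disjoint blocks of an independent family are independent.\<close>

lemma (in prob_space) indep_private_value_earlier:
  fixes Y :: "nat \<Rightarrow> 'a \<Rightarrow> real" and g :: "nat \<Rightarrow> nat"
  assumes Y: "indep_vars (\<lambda>_. borel) Y {..<m}" and S: "S \<subseteq> {k. k < n \<and> k \<noteq> i \<and> g k = g i}"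
  shows "indep_var borel (\<lambda>\<omega>. private_value n m A g (\<lambda>j. Y j \<omega>) i)
    borel (\<lambda>\<omega>. of_bool (\<forall>k\<in>S. item_value m A (\<lambda>j. Y j \<omega>) k < t) :: real)"
proof -
  define J where "J = {j. j < m \<and> (\<forall>k<n. k \<noteq> i \<and> g k = g i \<longrightarrow> A k j = 0)}"
  define L where "L = {..<m} - J"
  have finS: "finite S" by (rule finite_subset [OF S]) simp
  have fin: "finite J" "finite L" by (auto simp: J_def L_def)
  have item: "item_value m A (\<lambda>j. Y j \<omega>) k = (\<Sum>j\<in>L. A k j * Y j \<omega>)" if "k \<in> S" for k \<omega>
    unfolding item_value_def using S that
    by (intro sum.mono_neutral_right) (auto simp: L_def J_def)
  define f where "f = (\<lambda>v :: nat \<Rightarrow> real. \<Sum>j\<in>J. A i j * v j)"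
  define h where "h = (\<lambda>v :: nat \<Rightarrow> real. if \<forall>k\<in>S. (\<Sum>j\<in>L. A k j * v j) < t then 1 else 0 :: real)"
  have "indep_var (PiM J (\<lambda>_. borel)) (\<lambda>\<omega>. restrict (\<lambda>j. Y j \<omega>) J)
      (PiM L (\<lambda>_. borel)) (\<lambda>\<omega>. restrict (\<lambda>j. Y j \<omega>) L)"
    by (rule indep_var_restrict [OF Y]) (auto simp: J_def L_def)
  moreover have "f \<in> borel_measurable (PiM J (\<lambda>_. borel))" unfolding f_def by measurable
  moreover have "h \<in> borel_measurable (PiM L (\<lambda>_. borel))" unfolding h_def using finS by measurable
  ultimately have "indep_var borel (f \<circ> (\<lambda>\<omega>. restrict (\<lambda>j. Y j \<omega>) J))
      borel (h \<circ> (\<lambda>\<omega>. restrict (\<lambda>j. Y j \<omega>) L))"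
    by (rule indep_var_compose)
  also have "f \<circ> (\<lambda>\<omega>. restrict (\<lambda>j. Y j \<omega>) J) = (\<lambda>\<omega>. private_value n m A g (\<lambda>j. Y j \<omega>) i)"
    by (simp add: f_def private_value_def J_def fun_eq_iff)
  also have "h \<circ> (\<lambda>\<omega>. restrict (\<lambda>j. Y j \<omega>) L)
      = (\<lambda>\<omega>. of_bool (\<forall>k\<in>S. item_value m A (\<lambda>j. Y j \<omega>) k < t))"
    by (auto simp: h_def item fun_eq_iff)
  finally show ?thesis .
qed

section \<open>Deterministic rules and the bucket algorithm\<close>

text \<open>A rule without randomness fits the seeded model by taking the point mass at 0 as seed
  distribution; the integral over the seed then disappears.\<close>

lemma expected_alg_deterministic:
  fixes acc :: "real list \<Rightarrow> bool"
  assumes "prob_space M"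
    and Y [measurable]: "\<And>j. j < m \<Longrightarrow> Y j \<in> borel_measurable M"
    and acc: "\<And>i. i < n \<Longrightarrow> Measurable.pred (PiM {..i} (\<lambda>_. borel)) (\<lambda>x. acc (map x [0..<Suc i]))"
    and card: "\<And>x. card (accepted n (\<lambda>_ :: real. acc) 0 x) \<le> r"
  shows "online_algorithm n r (return borel 0) (\<lambda>_ :: real. acc)"
    and "expected_alg M n m A Y (return borel 0) (\<lambda>_ :: real. acc) =
      (\<integral>\<^sup>+ \<omega>. ennreal (alg_reward n (\<lambda>_ :: real. acc) 0 (item_value m A (\<lambda>j. Y j \<omega>))) \<partial>M)"
proof -
  interpret prob_space M by fact
  interpret S: prob_space "return borel (0 :: real)" by (rule prob_space_return) simp
  have card_u: "card (accepted n (\<lambda>_ :: real. acc) u x) \<le> r" for u x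
    using card [of x] by (simp add: accepted_def)
  have "Measurable.pred (return borel (0 :: real) \<Otimes>\<^sub>M PiM {..i} (\<lambda>_. borel)) (\<lambda>(u, x). acc (map x [0..<Suc i]))"
    if "i < n" for i
    using measurable_compose [OF measurable_snd acc [OF that], of "return borel (0 :: real)"]
    by (simp add: case_prod_beta')
  then show "online_algorithm n r (return borel 0) (\<lambda>_ :: real. acc)"
    using S.prob_space_axioms card_u by (simp add: online_algorithm_def)
  let ?x = "\<lambda>\<omega>. item_value m A (\<lambda>j. Y j \<omega>)"
  have [measurable]: "(\<lambda>\<omega>. ?x \<omega> i) \<in> borel_measurable M" for i
    unfolding item_value_def by measurable
  have pred [measurable]: "Measurable.pred M (\<lambda>\<omega>. acc (map (?x \<omega>) [0..<Suc i]))" if "i < n" for i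
  proof -
    \<comment> \<open>The rule is known to be measurable on the product over \<open>{..i}\<close>.
      Restricting the values to these indices leaves the observed list unchanged.\<close>
    have "(\<lambda>\<omega>. restrict (?x \<omega>) {..i}) \<in> measurable M (PiM {..i} (\<lambda>_. borel))"
      by (intro measurable_restrict) simp
    then have "Measurable.pred M (\<lambda>\<omega>. acc (map (restrict (?x \<omega>) {..i}) [0..<Suc i]))"
      by (rule measurable_compose [OF _ acc [OF that]])
    moreover have "map (restrict (?x \<omega>) {..i}) [0..<Suc i] = map (?x \<omega>) [0..<Suc i]" for \<omega>
      by (rule map_cong) auto
    ultimately show ?thesis by (simp del: upt_Suc)
  qed
  have reward: "alg_reward n (\<lambda>_ :: real. acc) u x = (\<Sum>i<n. if acc (map x [0..<Suc i]) then x i else 0)" for u x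
    unfolding alg_reward_def accepted_def
    using sum.inter_filter [of "{..<n}" x "\<lambda>i. acc (map x [0..<Suc i])"] by (simp del: upt_Suc)
  let ?R = "\<lambda>\<omega>. ennreal (alg_reward n (\<lambda>_ :: real. acc) 0 (?x \<omega>))"
  have "?R \<in> borel_measurable M"
    unfolding reward using pred by (intro measurable_compose [OF _ measurable_ennreal] borel_measurable_sum measurable_If) auto
  then have R: "(\<lambda>p. ?R (snd p)) \<in> borel_measurable (return borel (0 :: real) \<Otimes>\<^sub>M M)"
    by (rule measurable_compose [OF measurable_snd])
  have "expected_alg M n m A Y (return borel 0) (\<lambda>_ :: real. acc)
      = (\<integral>\<^sup>+ p. ?R (snd p) \<partial>(return borel (0 :: real) \<Otimes>\<^sub>M M))"
    by (simp add: expected_alg_def reward case_prod_beta')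
  also have "\<dots> = (\<integral>\<^sup>+ u. \<integral>\<^sup>+ \<omega>. ?R \<omega> \<partial>M \<partial>return borel (0 :: real))"
    using nn_integral_fst [OF R] by simp
  also have "\<dots> = (\<integral>\<^sup>+ \<omega>. ?R \<omega> \<partial>M)"
    by (simp add: S.emeasure_space_1 del: space_return)
  finally show "expected_alg M n m A Y (return borel 0) (\<lambda>_ :: real. acc) = (\<integral>\<^sup>+ \<omega>. ?R \<omega> \<partial>M)" .
qed

text \<open>The length of the observed list reveals which item is current. No record of past
  decisions is kept: a bucket \<open>c < r\<close> has been served exactly when one of its earlier
  values reached \<open>\<tau> c\<close>.\<close>

definition bucket_rule :: "nat \<Rightarrow> (nat \<Rightarrow> nat) \<Rightarrow> (nat \<Rightarrow> real) \<Rightarrow> real list \<Rightarrow> bool" where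
  "bucket_rule r g \<tau> xs \<longleftrightarrow> (let i = length xs - 1; c = g i in
     c < r \<and> \<tau> c \<le> xs ! i \<and> (\<forall>k<i. g k = c \<longrightarrow> xs ! k < \<tau> c))"

lemma bucket_rule_map:
  "bucket_rule r g \<tau> (map x [0..<Suc i]) \<longleftrightarrow>
     g i < r \<and> \<tau> (g i) \<le> x i \<and> (\<forall>k\<in>{k. k < i \<and> g k = g i}. x k < \<tau> (g i))"
  by (auto simp: bucket_rule_def Let_def nth_append simp del: upt_Suc)

text \<open>No bucket is served twice, since the later of two items would find the earlier one at or
  above the threshold. So \<open>g\<close> maps the accepted items injectively into the first
  \<open>r\<close> buckets.\<close>

lemma card_accepted_bucket_rule: "card (accepted n (\<lambda>_ :: 'u. bucket_rule r g \<tau>) u x) \<le> r"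
proof -
  let ?Q = "accepted n (\<lambda>_ :: 'u. bucket_rule r g \<tau>) u x"
  have "inj_on g ?Q"
  proof (rule inj_onI)
    fix i k assume "i \<in> ?Q" "k \<in> ?Q" "g i = g k"
    then show "i = k"
      by (cases i k rule: linorder_cases) (force simp: accepted_def bucket_rule_map simp del: upt_Suc)+
  qed
  moreover have "g ` ?Q \<subseteq> {..<r}" by (auto simp: accepted_def bucket_rule_map simp del: upt_Suc)
  ultimately have "card ?Q \<le> card {..<r}" by (intro card_inj_on_le) auto
  then show ?thesis by simp
qed

text \<open>Grouping the accepted items by bucket brings the reward into the form treated by
  \<open>threshold_stopping_half\<close>.\<close>

lemma alg_reward_bucket_rule:
  "alg_reward n (\<lambda>_ :: 'u. bucket_rule r g \<tau>) u x =
     (\<Sum>c<r. \<Sum>i | i < n \<and> g i = c.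
        x i * of_bool (\<tau> c \<le> x i \<and> (\<forall>k\<in>{k \<in> {i. i < n \<and> g i = c}. k < i}. x k < \<tau> c)))"
proof -
  let ?Q = "accepted n (\<lambda>_ :: 'u. bucket_rule r g \<tau>) u x"
  have finQ: "finite ?Q" by (simp add: accepted_def)
  have "alg_reward n (\<lambda>_ :: 'u. bucket_rule r g \<tau>) u x = (\<Sum>c<r. sum x {i \<in> ?Q. g i = c})"
    unfolding alg_reward_def
    by (rule sum.group [symmetric, OF finQ])
      (auto simp: accepted_def bucket_rule_map simp del: upt_Suc)
  also have "\<dots> = (\<Sum>c<r. \<Sum>i | i < n \<and> g i = c.
        x i * of_bool (\<tau> c \<le> x i \<and> (\<forall>k\<in>{k \<in> {i. i < n \<and> g i = c}. k < i}. x k < \<tau> c)))"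
  proof (rule sum.cong [OF refl])
    fix c assume c: "c \<in> {..<r}"
    have "{i \<in> ?Q. g i = c} = {i. i < n \<and> g i = c} \<inter>
        {i. \<tau> c \<le> x i \<and> (\<forall>k\<in>{k \<in> {i. i < n \<and> g i = c}. k < i}. x k < \<tau> c)}"
      using c by (auto simp: accepted_def bucket_rule_map simp del: upt_Suc)
    then show "sum x {i \<in> ?Q. g i = c} = (\<Sum>i | i < n \<and> g i = c.
        x i * of_bool (\<tau> c \<le> x i \<and> (\<forall>k\<in>{k \<in> {i. i < n \<and> g i = c}. k < i}. x k < \<tau> c)))"
      using sum_mult_of_bool_eq [of "{i. i < n \<and> g i = c}" x] by simp
  qed
  finally show ?thesis .
qed

section \<open>Choice of a bucket assignment with thresholds, and the final constant\<close>

theorem theoremC1: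
  fixes s r n m :: nat
    and A :: "nat \<Rightarrow> nat \<Rightarrow> real"
    and M :: "'a measure"
    and Y :: "nat \<Rightarrow> 'a \<Rightarrow> real"
  assumes "s \<ge> 1" and "r \<ge> 1"
    and "\<And>i j. i < n \<Longrightarrow> j < m \<Longrightarrow> A i j \<ge> 0"
    and "column_sparsity n m A = s"
    and "prob_space M"
    and "prob_space.indep_vars M (\<lambda>_. borel) Y {..<m}"
    and "\<And>j \<omega>. j < m \<Longrightarrow> \<omega> \<in> space M \<Longrightarrow> Y j \<omega> \<ge> 0"
  shows "\<exists>(S :: real measure) acc. online_algorithm n r S acc \<and>
           expected_alg M n m A Y S acc \<ge>
             ennreal (1 / (2 * (exp 1)\<^sup>2 * max 1 (real s / real r))) * expected_opt M n m r A Y"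
proof -
  interpret prob_space M by fact
  have A: "\<And>i j. i < n \<Longrightarrow> j < m \<Longrightarrow> A i j \<ge> 0" by fact
  have Y0: "\<And>j \<omega>. j < m \<Longrightarrow> \<omega> \<in> space M \<Longrightarrow> Y j \<omega> \<ge> 0" by fact
  have mY [measurable]: "Y j \<in> borel_measurable M" if "j < m" for j
    using assms(6) that unfolding indep_vars_def by auto
  define X where "X i \<omega> = item_value m A (\<lambda>j. Y j \<omega>) i" for i \<omega>
  have mX [measurable]: "X i \<in> borel_measurable M" for i
    unfolding X_def item_value_def by measurable
  have X0: "0 \<le> X i \<omega>" if "i < n" "\<omega> \<in> space M" for i \<omega>
    unfolding X_def item_value_def using that by (auto intro!: sum_nonneg mult_nonneg_nonneg A Y0)
  show ?thesis
  proof (cases "\<exists>i<n. (\<integral>\<^sup>+ \<omega>. ennreal (X i \<omega>) \<partial>M) = \<infinity>")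
    case True \<comment> \<open>no finite threshold exists, but accepting one fixed item has infinite expected reward\<close>
    then obtain i where i: "i < n" "(\<integral>\<^sup>+ \<omega>. ennreal (X i \<omega>) \<partial>M) = \<infinity>" by blast
    define acc where "acc xs \<longleftrightarrow> length xs = Suc i" for xs :: "real list"
    have Q: "accepted n (\<lambda>_ :: real. acc) u x = {i}" for u x
      using i(1) by (auto simp: accepted_def acc_def)
    have pred: "Measurable.pred (PiM {..k} (\<lambda>_. borel)) (\<lambda>x :: nat \<Rightarrow> real. acc (map x [0..<Suc k]))" for k
      by (simp add: acc_def)
    have card_Q: "card (accepted n (\<lambda>_ :: real. acc) 0 x) \<le> r" for x
      using \<open>r \<ge> 1\<close> by (simp add: Q)
    have "online_algorithm n r (return borel 0) (\<lambda>_ :: real. acc)"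
      and "expected_alg M n m A Y (return borel 0) (\<lambda>_ :: real. acc) =
        (\<integral>\<^sup>+ \<omega>. ennreal (alg_reward n (\<lambda>_ :: real. acc) 0 (item_value m A (\<lambda>j. Y j \<omega>))) \<partial>M)"
      by (rule expected_alg_deterministic [OF assms(5) mY pred card_Q]; assumption)+
    moreover have "alg_reward n (\<lambda>_ :: real. acc) 0 (item_value m A (\<lambda>j. Y j \<omega>)) = X i \<omega>" for \<omega>
      by (simp add: alg_reward_def Q X_def)
    ultimately show ?thesis using i(2) by (intro exI conjI) auto
  next
    case False
    \<comment> \<open>At least \<open>r\<close>, so that the first \<open>r\<close> buckets exist,
      and at least \<open>s\<close>, so that items sharing a column are likely to be separated. The
      choice gives \<open>N / r = max 1 (s / r)\<close>.\<close>
    define N where "N = max r s"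
    have N1: "N \<ge> 1" and r0: "real r > 0" using \<open>r \<ge> 1\<close> by (auto simp: N_def)
    let ?G = "{..<n} \<rightarrow>\<^sub>E {..<N}"
    define T where "T g c = {i. i < n \<and> g i = c}" for g :: "nat \<Rightarrow> nat" and c
    define Z where "Z g i \<omega> = private_value n m A g (\<lambda>j. Y j \<omega>) i" for g i \<omega>
    define W where "W g \<omega> = (\<Sum>c<r. Max (insert 0 ((\<lambda>i. Z g i \<omega>) ` T g c)))" for g \<omega>
    have finT: "finite (T g c)" for g c by (simp add: T_def)
    have mZ [measurable]: "Z g i \<in> borel_measurable M" for g i
      unfolding Z_def private_value_def by measurable
    have Z0: "0 \<le> Z g i \<omega>" and ZX: "Z g i \<omega> \<le> X i \<omega>" if "i < n" "\<omega> \<in> space M" for g i \<omega>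
      unfolding Z_def X_def using that
      by (auto intro!: private_value_nonneg private_value_le_item_value A Y0)
    have intX: "integrable M (X i)" if "i < n" for i
      using False that X0 by (intro integrableI_nonneg) (auto simp: less_top)
    have intZ: "integrable M (Z g i)" if "i < n" for g i
      by (rule Bochner_Integration.integrable_bound [OF intX [OF that]])
        (use Z0 ZX X0 that in \<open>auto intro!: AE_I2\<close>)
    have int_Max: "integrable M (\<lambda>\<omega>. Max (insert 0 ((\<lambda>i. Z g i \<omega>) ` T g c)))" for g c
      by (intro integrable_Max_insert_0 finT intZ) (simp add: T_def)
    have intW: "integrable M (W g)" for g
      unfolding W_def using int_Max by auto
    have W0: "0 \<le> W g \<omega>" for g \<omega>
      unfolding W_def using finT by (intro sum_nonneg Max_ge) auto
    have finG: "finite ?G" by (simp add: finite_PiE)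
    have "(\<lambda>i\<in>{..<n}. 0) \<in> ?G" using N1 by auto
    then have neG: "(\<lambda>g. expectation (W g)) ` ?G \<noteq> {}" by blast
    \<comment> \<open>An assignment of maximal value is at least as good as the average over all
      \<open>N ^ n\<close> of them, which removes the randomness from the choice of buckets.\<close>
    obtain g where g: "expectation (W g) = Max ((\<lambda>g. expectation (W g)) ` ?G)"
      using Max_in [OF finite_imageI [OF finG] neG] by auto
    have "(\<Sum>g\<in>?G. expectation (W g)) \<le> of_nat (card ?G) * expectation (W g)"
      using finG unfolding g by (intro sum_bounded_above Max_ge) auto
    then have best: "(\<Sum>g\<in>?G. expectation (W g)) \<le> real N ^ n * expectation (W g)"
      by (simp add: card_PiE)

    \<comment> \<open>This is the factor of the counting bound; its part \<open>N ^ n\<close>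
      cancels against the number of assignments.\<close>
    define q where "q = real r / real N * exp (-2) * real N ^ n"
    have q0: "q > 0" using N1 r0 by (simp add: q_def)
    have "expected_opt M n m r A Y \<le> (\<integral>\<^sup>+ \<omega>. ennreal ((\<Sum>g\<in>?G. W g \<omega>) / q) \<partial>M)"
      unfolding expected_opt_def
    proof (intro nn_integral_mono ennreal_leI)
      fix \<omega> assume \<omega>: "\<omega> \<in> space M"
      have "q * opt_reward n r (item_value m A (\<lambda>j. Y j \<omega>)) \<le> (\<Sum>g\<in>?G. W g \<omega>)"
        unfolding q_def W_def Z_def T_def
        using assms(1,2,4) A Y0 [OF _ \<omega>] N_def by (intro sum_colourings_private_value_ge) auto
      then show "opt_reward n r (item_value m A (\<lambda>j. Y j \<omega>)) \<le> (\<Sum>g\<in>?G. W g \<omega>) / q"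
        using q0 by (simp add: field_simps)
    qed
    also have "\<dots> = ennreal (expectation (\<lambda>\<omega>. (\<Sum>g\<in>?G. W g \<omega>) / q))"
      using intW W0 q0
      by (intro nn_integral_eq_integral) (auto intro!: AE_I2 divide_nonneg_pos sum_nonneg)
    also have "expectation (\<lambda>\<omega>. (\<Sum>g\<in>?G. W g \<omega>) / q) = (\<Sum>g\<in>?G. expectation (W g)) / q"
      using intW by simp
    also have "ennreal \<dots> \<le> ennreal (real N ^ n * expectation (W g) / q)"
      using best q0 by (intro ennreal_leI divide_right_mono) auto
    finally have opt: "expected_opt M n m r A Y \<le> ennreal (real N ^ n * expectation (W g) / q)" .

    \<comment> \<open>The thresholds depend only on \<open>A\<close>, \<open>g\<close> and the
      distributions, all fixed before the first item arrives.\<close>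
    define \<tau> where "\<tau> c = expectation (\<lambda>\<omega>. Max (insert 0 ((\<lambda>i. Z g i \<omega>) ` T g c))) / 2" for c
    define R where "R c \<omega> = (\<Sum>i\<in>T g c. X i \<omega> * of_bool (\<tau> c \<le> X i \<omega> \<and> (\<forall>k\<in>{k \<in> T g c. k < i}. X k \<omega> < \<tau> c)))" for c \<omega>
    have "integrable M (R c) \<and> \<tau> c \<le> expectation (R c)" for c
    proof -
      have indep: "indep_var borel (Z g i) borel (\<lambda>\<omega>. of_bool (\<forall>k\<in>{k \<in> T g c. k < i}. X k \<omega> < t) :: real)"
        if "i \<in> T g c" for i t
        unfolding Z_def X_def
        by (rule indep_private_value_earlier [OF assms(6)]) (use that in \<open>auto simp: T_def\<close>)
      show ?thesis
        unfolding R_def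
        by (intro conjI threshold_stopping_half [OF finT intX intZ ZX indep \<tau>_def]) (simp_all add: T_def)
    qed
    then have intR: "integrable M (R c)" and \<tau>R: "\<tau> c \<le> expectation (R c)" for c by auto
    have R0: "0 \<le> R c \<omega>" if "\<omega> \<in> space M" for c \<omega>
      unfolding R_def using that X0 by (intro sum_nonneg mult_nonneg_nonneg) (auto simp: T_def)

    let ?acc = "\<lambda>_ :: real. bucket_rule r g \<tau>"
    have pred: "Measurable.pred (PiM {..i} (\<lambda>_. borel)) (\<lambda>x. bucket_rule r g \<tau> (map x [0..<Suc i]))" for i
    proof -
      have [measurable]: "(\<lambda>x. x k) \<in> borel_measurable (PiM {..i} (\<lambda>_. borel :: real measure))" if "k \<le> i" for k
        using that by (intro measurable_component_singleton) simp
      have [measurable]: "(\<lambda>x. x k) \<in> borel_measurable (PiM {..i} (\<lambda>_. borel :: real measure))"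
        if "k \<in> {k. k < i \<and> g k = g i}" for k
        using that by (intro measurable_component_singleton) auto
      show ?thesis unfolding bucket_rule_map by measurable
    qed
    have online: "online_algorithm n r (return borel 0) ?acc"
      and "expected_alg M n m A Y (return borel 0) ?acc =
        (\<integral>\<^sup>+ \<omega>. ennreal (alg_reward n ?acc 0 (item_value m A (\<lambda>j. Y j \<omega>))) \<partial>M)"
      by (rule expected_alg_deterministic [OF assms(5) mY pred card_accepted_bucket_rule]; assumption)+
    note this(2)
    also have "(\<lambda>\<omega>. alg_reward n ?acc 0 (item_value m A (\<lambda>j. Y j \<omega>))) = (\<lambda>\<omega>. \<Sum>c<r. R c \<omega>)"
      unfolding alg_reward_bucket_rule R_def T_def X_def ..
    also have "(\<integral>\<^sup>+ \<omega>. ennreal (\<Sum>c<r. R c \<omega>) \<partial>M) = ennreal (expectation (\<lambda>\<omega>. \<Sum>c<r. R c \<omega>))"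
      using intR R0 by (intro nn_integral_eq_integral) (auto intro!: sum_nonneg)
    also have "expectation (\<lambda>\<omega>. \<Sum>c<r. R c \<omega>) = (\<Sum>c<r. expectation (R c))"
      using intR by simp
    finally have alg: "expected_alg M n m A Y (return borel 0) ?acc = ennreal (\<Sum>c<r. expectation (R c))" .
    have "expectation (W g) / 2 = (\<Sum>c<r. \<tau> c)"
      unfolding W_def \<tau>_def by (subst Bochner_Integration.integral_sum) (simp_all add: int_Max sum_divide_distrib)
    also have "\<dots> \<le> (\<Sum>c<r. expectation (R c))" by (intro sum_mono \<tau>R)
    finally have half: "expectation (W g) / 2 \<le> (\<Sum>c<r. expectation (R c))" .

    have maxN: "max 1 (real s / real r) = real N / real r"
      using r0 by (auto simp: N_def max_def field_simps)
    \<comment> \<open>The quotient \<open>N ^ n / q\<close> equals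
      \<open>(N / r) * (exp 1)\<^sup>2\<close>. Thus all of the target constant cancels except the
      2, which is the loss from the threshold rule.\<close>
    have const: "1 / (2 * (exp 1)\<^sup>2 * max 1 (real s / real r)) * (real N ^ n * expectation (W g) / q)
        = expectation (W g) / 2"
      using N1 r0 unfolding maxN q_def exp_minus
      by (simp add: field_simps power2_eq_square flip: exp_add)
    have "ennreal (1 / (2 * (exp 1)\<^sup>2 * max 1 (real s / real r))) * expected_opt M n m r A Y
        \<le> ennreal (1 / (2 * (exp 1)\<^sup>2 * max 1 (real s / real r))) * ennreal (real N ^ n * expectation (W g) / q)"
      using opt by (rule mult_left_mono) simp
    also have "\<dots> = ennreal (expectation (W g) / 2)"
      by (subst ennreal_mult' [symmetric]) (simp_all only: const, simp)
    also have "\<dots> \<le> expected_alg M n m A Y (return borel 0) ?acc"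
      unfolding alg using half by (rule ennreal_leI)
    finally show ?thesis using online by blast
  qed
qed

end
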